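(* Let $(X,\Phi)$ and $(Y,\Psi)$ be flows that are topologically equivalent via a homeomorphism $h:X\to Y$, and let $A\subset X$ and $B\subset Y$ be regular open sets with $B=h(A)$. Then for every $x\in\partial A$, the point $x\in\partial A$ (with respect to $\Phi$ and $A$) and the point $h(x)\in\partial B$ (with respect to $\Psi$ and $B$) have the same type.
   Context: A flow $(X,\Phi)$ on a topological space $X$ is a continuous map $\Phi:\mathbb{R}\times X\to X$ with $\Phi(0,x)=x$ and $\Phi(s+t,x)=\Phi(s,\Phi(t,x))$. Two flows $(X,\Phi)$, $(Y,\Psi)$ are topologically equivalent via a homeomorphism $h:X\to Y$ if $h$ maps each orbit of $\Phi$ onto an orbit of $\Psi$ preserving the direction of time. An open set $A$ is regular if $\partial A=\partial\bar A$. A partial map is a map defined on a subset (its domain $\mathrm{dom}$) of its source. First-out map: for an open set $A\subset X$, $E_A:\partial A\to\partial A$ is the partial map $E_A(x)=\Phi(T^e_A(x),x)$, where $T^e_A(x)=\inf\{t>0\mid\Phi(t,x)\notin A\}$; $x\in\mathrm{dom}\,E_A$ iff this set of times is nonempty. First-in map: for a closed set $B\subset X$, $R_B:\partial B\to\partial B$ is the partial map $R_B(x)=\Phi(T^r_B(x),x)$, where $T^r_B(x)=\inf\{t>0\mid\Phi(t,x)\in B\}$; $x\in\mathrm{dom}\,R_B$ iff this set of times is nonempty. Types: for a regular open set $A$, a point $x\in\partial A$ is of type A-1 if $x\in\mathrm{dom}\,E_A\cap\mathrm{dom}\,R_{\bar A}$, $E_A(x)=x$ and $R_{\bar A}(x)\ne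 x$; type A-2 if $x\in\mathrm{dom}\,E_A\cap\mathrm{dom}\,R_{\bar A}$, $E_A(x)\neq x$ and $R_{\bar A}(x)=x$; type A-3 if $x\in\mathrm{dom}\,E_A\cap\mathrm{dom}\,R_{\bar A}$, $E_A(x)=x$ and $R_{\bar A}(x)=x$; type B if $x\in\mathrm{dom}\,E_A\setminus\mathrm{dom}\,R_{\bar A}$; type C if $x\in\mathrm{dom}\,R_{\bar A}\setminus\mathrm{dom}\,E_A$. *)

theory Defs
  imports "HOL-Analysis.Analysis"
begin

definition flow :: "(real \<Rightarrow> 'a::topological_space \<Rightarrow> 'a) \<Rightarrow> bool" where
  "flow \<Phi> \<longleftrightarrow>
     continuous_on UNIV (\<lambda>(t, x). \<Phi> t x) \<and>
     (\<forall>x. \<Phi> 0 x = x) \<and>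
     (\<forall>s t x. \<Phi> (s + t) x = \<Phi> s (\<Phi> t x))"

definition orbit_of :: "(real \<Rightarrow> 'a \<Rightarrow> 'a) \<Rightarrow> 'a \<Rightarrow> 'a set" where
  "orbit_of \<Phi> x = range (\<lambda>t. \<Phi> t x)"

text \<open>
  A map \<open>h\<close> preserves the direction of time along the orbit of \<open>x\<close> if it carries the
  parametrised orbit of \<open>x\<close> to that of \<open>h x\<close> up to an increasing change of time. A strictly
  increasing surjection of the real line is automatically a homeomorphism. Comparing merely the
  forward half-orbits as sets would not do: on a periodic orbit they do not determine a direction.
\<close>

definition preserves_time_direction ::
  "(real \<Rightarrow> 'a \<Rightarrow> 'a) \<Rightarrow> (real \<Rightarrow> 'b \<Rightarrow> 'b) \<Rightarrow> ('a \<Rightarrow> 'b) \<Rightarrow> 'a \<Rightarrow> bool" where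
  "preserves_time_direction \<Phi> \<Psi> h x \<longleftrightarrow>
     (\<exists>\<tau>::real \<Rightarrow> real. strict_mono \<tau> \<and> surj \<tau> \<and> \<tau> 0 = 0 \<and>
        (\<forall>t. h (\<Phi> t x) = \<Psi> (\<tau> t) (h x)))"

definition topologically_equivalent_via ::
  "(real \<Rightarrow> 'a::topological_space \<Rightarrow> 'a) \<Rightarrow> (real \<Rightarrow> 'b::topological_space \<Rightarrow> 'b) \<Rightarrow>
   ('a \<Rightarrow> 'b) \<Rightarrow> bool" where
  "topologically_equivalent_via \<Phi> \<Psi> h \<longleftrightarrow>
     (\<exists>g. homeomorphism UNIV UNIV h g) \<and>
     (\<forall>x. h ` orbit_of \<Phi> x = orbit_of \<Psi> (h x) \<and> preserves_time_direction \<Phi> \<Psi> h x)"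

text \<open>This is not the notion of regular open set given by \<open>interior (closure A) = A\<close>.\<close>

definition regular_open_set :: "'a::topological_space set \<Rightarrow> bool" where
  "regular_open_set A \<longleftrightarrow> open A \<and> frontier A = frontier (closure A)"

definition exit_times :: "(real \<Rightarrow> 'a \<Rightarrow> 'a) \<Rightarrow> 'a set \<Rightarrow> 'a \<Rightarrow> real set" where
  "exit_times \<Phi> A x = {t. t > 0 \<and> \<Phi> t x \<notin> A}"

definition return_times :: "(real \<Rightarrow> 'a \<Rightarrow> 'a) \<Rightarrow> 'a set \<Rightarrow> 'a \<Rightarrow> real set" where
  "return_times \<Phi> B x = {t. t > 0 \<and> \<Phi> t x \<in> B}"

definition first_out :: "(real \<Rightarrow> 'a::topological_space \<Rightarrow> 'a) \<Rightarrow> 'a set \<Rightarrow> 'a \<rightharpoonup> 'a" where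
  "first_out \<Phi> A x =
     (if x \<in> frontier A \<and> exit_times \<Phi> A x \<noteq> {}
      then Some (\<Phi> (Inf (exit_times \<Phi> A x)) x) else None)"

definition first_in :: "(real \<Rightarrow> 'a::topological_space \<Rightarrow> 'a) \<Rightarrow> 'a set \<Rightarrow> 'a \<rightharpoonup> 'a" where
  "first_in \<Phi> B x =
     (if x \<in> frontier B \<and> return_times \<Phi> B x \<noteq> {}
      then Some (\<Phi> (Inf (return_times \<Phi> B x)) x) else None)"

datatype point_type = Type_A1 | Type_A2 | Type_A3 | Type_B | Type_C

fun has_type ::
  "(real \<Rightarrow> 'a::topological_space \<Rightarrow> 'a) \<Rightarrow> 'a set \<Rightarrow> 'a \<Rightarrow> point_type \<Rightarrow> bool" where
  "has_type \<Phi> A x Type_A1 \<longleftrightarrow> x \<in> frontier A \<and>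
     x \<in> dom (first_out \<Phi> A) \<inter> dom (first_in \<Phi> (closure A)) \<and>
     the (first_out \<Phi> A x) = x \<and> the (first_in \<Phi> (closure A) x) \<noteq> x"
| "has_type \<Phi> A x Type_A2 \<longleftrightarrow> x \<in> frontier A \<and>
     x \<in> dom (first_out \<Phi> A) \<inter> dom (first_in \<Phi> (closure A)) \<and>
     the (first_out \<Phi> A x) \<noteq> x \<and> the (first_in \<Phi> (closure A) x) = x"
| "has_type \<Phi> A x Type_A3 \<longleftrightarrow> x \<in> frontier A \<and>
     x \<in> dom (first_out \<Phi> A) \<inter> dom (first_in \<Phi> (closure A)) \<and>
     the (first_out \<Phi> A x) = x \<and> the (first_in \<Phi> (closure A) x) = x"
| "has_type \<Phi> A x Type_B \<longleftrightarrow> x \<in> frontier A \<and>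
     x \<in> dom (first_out \<Phi> A) - dom (first_in \<Phi> (closure A))"
| "has_type \<Phi> A x Type_C \<longleftrightarrow> x \<in> frontier A \<and>
     x \<in> dom (first_in \<Phi> (closure A)) - dom (first_out \<Phi> A)"

end

theory Submission
  imports Defs
begin

text \<open>
  The increasing time change along the orbit of a point carries the exit and return times of the
  point onto those of its image and, being an order isomorphism of the real line, commutes with
  their infima. So \<open>h\<close> intertwines the first-out and the first-in maps, on which alone the types
  depend.
\<close>

text \<open>By surjectivity every lower bound of the image has the form \<open>\<tau> u\<close>. A
  strictly monotone map of linear orders reflects the order, so \<open>u\<close> bounds
  \<open>S\<close> from below.\<close>

lemma strict_mono_surj_Inf_image:
  fixes \<tau> :: "'a::conditionally_complete_linorder \<Rightarrow> 'b::conditionally_complete_linorder"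
  assumes "strict_mono \<tau>" "surj \<tau>" "S \<noteq> {}" "bdd_below S"
  shows "Inf (\<tau> ` S) = \<tau> (Inf S)"
proof (rule cInf_eq_non_empty)
  show "\<tau> ` S \<noteq> {}" using assms(3) by simp
  show "\<tau> (Inf S) \<le> y" if "y \<in> \<tau> ` S" for y
    using that assms by (auto simp: strict_mono_less_eq intro: cInf_lower)
  show "y \<le> \<tau> (Inf S)" if "\<And>z. z \<in> \<tau> ` S \<Longrightarrow> y \<le> z" for y
  proof -
    obtain u where u: "y = \<tau> u" using assms(2) by (meson surjE)
    have "u \<le> Inf S"
    proof (rule cInf_greatest[OF assms(3)])
      fix s assume "s \<in> S"
      then have "\<tau> u \<le> \<tau> s" using that u by simp
      then show "u \<le> s" using assms(1) by (simp add: strict_mono_less_eq)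
    qed
    then show ?thesis using assms(1) u by (simp add: strict_mono_less_eq)
  qed
qed

text \<open>Continuity of \<open>h\<close> gives one inclusion; the other is the same inclusion for
  the inverse \<open>g\<close>, pushed forward by \<open>h\<close>.\<close>

lemma homeomorphism_closure_image:
  assumes "homeomorphism UNIV UNIV h g"
  shows "closure (h ` S) = h ` closure S"
proof
  have cont: "continuous_on T h" "continuous_on T' g" for T T'
    using assms unfolding homeomorphism_def by (auto intro: continuous_on_subset)
  have gh: "g ` h ` T = T" and hg: "h ` g ` T' = T'" for T T'
    using assms by (simp_all add: homeomorphism_def image_image)
  show "h ` closure S \<subseteq> closure (h ` S)"
    by (rule image_closure_subset[OF cont(1) closed_closure closure_subset])
  have "g ` closure (h ` S) \<subseteq> closure (g ` h ` S)"
    by (rule image_closure_subset[OF cont(2) closed_closure closure_subset])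
  then have "h ` g ` closure (h ` S) \<subseteq> h ` closure (g ` h ` S)"
    by (rule image_mono)
  then show "closure (h ` S) \<subseteq> h ` closure S"
    unfolding gh hg .
qed

lemma homeomorphism_imp_bij:
  assumes "homeomorphism UNIV UNIV h g"
  shows "bij h"
  using assms unfolding homeomorphism_def by (metis UNIV_I bij_iff)

lemma homeomorphism_frontier_image:
  assumes "homeomorphism UNIV UNIV h g"
  shows "frontier (h ` S) = h ` frontier S"
proof -
  have "bij h" using assms by (rule homeomorphism_imp_bij)
  then show ?thesis
    unfolding frontier_closures homeomorphism_closure_image[OF assms, symmetric]
    by (metis assms bij_def bij_image_Compl_eq homeomorphism_closure_image image_Int)
qed

context
  fixes \<Phi> :: "real \<Rightarrow> 'a::topological_space \<Rightarrow> 'a"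
    and \<Psi> :: "real \<Rightarrow> 'b::topological_space \<Rightarrow> 'b"
    and h :: "'a \<Rightarrow> 'b"
  assumes equivalent: "topologically_equivalent_via \<Phi> \<Psi> h"
begin

text \<open>The last property lets a single \<open>\<tau>\<close> transport every set of positive
  times cut out by a condition \<open>P\<close>, be it one of exit or of return.\<close>

lemma obtain_time_change:
  obtains \<tau> :: "real \<Rightarrow> real" where "strict_mono \<tau>" "surj \<tau>" "\<And>t. h (\<Phi> t x) = \<Psi> (\<tau> t) (h x)"
    "\<And>P. \<tau> ` {t. t > 0 \<and> P (\<tau> t)} = {t. t > 0 \<and> P t}"
proof -
  obtain \<tau> :: "real \<Rightarrow> real" where \<tau>: "strict_mono \<tau>" "surj \<tau>" "\<tau> 0 = 0"
      "\<forall>t. h (\<Phi> t x) = \<Psi> (\<tau> t) (h x)"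
    using equivalent unfolding topologically_equivalent_via_def preserves_time_direction_def by blast
  \<comment> \<open>The direction of time enters here: an increasing \<open>\<tau>\<close> fixing 0
    preserves and reflects positivity.\<close>
  have pos: "\<tau> t > 0 \<longleftrightarrow> t > 0" for t
    using strict_mono_less[OF \<tau>(1), of 0 t] \<tau>(3) by simp
  have "\<tau> ` {t. t > 0 \<and> P (\<tau> t)} = {t. t > 0 \<and> P t}" for P
  proof
    show "{t. t > 0 \<and> P t} \<subseteq> \<tau> ` {t. t > 0 \<and> P (\<tau> t)}"
      using pos \<tau>(2) by (smt (verit) image_eqI mem_Collect_eq subsetI surjE)
  qed (auto simp: pos)
  then show thesis using that \<tau> by blast
qed

lemma bij_h: "bij h"
  using equivalent unfolding topologically_equivalent_via_def by (metis homeomorphism_imp_bij)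

lemma closure_h: "closure (h ` S) = h ` closure S"
  using equivalent unfolding topologically_equivalent_via_def by (metis homeomorphism_closure_image)

lemma frontier_h: "frontier (h ` S) = h ` frontier S"
  using equivalent unfolding topologically_equivalent_via_def by (metis homeomorphism_frontier_image)

lemma h_mem_image_iff: "h y \<in> h ` S \<longleftrightarrow> y \<in> S"
  using bij_h by (simp add: bij_def inj_image_mem_iff)

text \<open>Taking \<open>S\<close> arbitrary covers both maps: returns are visits to the set
  itself, exits are visits to the complement. The formula for the infima is restricted to nonempty
  sets of times, where \<open>Inf\<close> is meaningful.\<close>

lemma first_time_image:
  "({t. t > 0 \<and> \<Psi> t (h x) \<in> h ` S} = {} \<longleftrightarrow> {t. t > 0 \<and> \<Phi> t x \<in> S} = {}) \<and>
   ({t. t > 0 \<and> \<Phi> t x \<in> S} \<noteq> {} \<longrightarrow>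
      \<Psi> (Inf {t. t > 0 \<and> \<Psi> t (h x) \<in> h ` S}) (h x) = h (\<Phi> (Inf {t. t > 0 \<and> \<Phi> t x \<in> S}) x))"
proof -
  obtain \<tau> :: "real \<Rightarrow> real" where \<tau>: "strict_mono \<tau>" "surj \<tau>" "\<And>t. h (\<Phi> t x) = \<Psi> (\<tau> t) (h x)"
    and img: "\<And>P. \<tau> ` {t. t > 0 \<and> P (\<tau> t)} = {t. t > 0 \<and> P t}"
    by (rule obtain_time_change[of x]) (rule that)
  have eq: "{t. t > 0 \<and> \<Psi> t (h x) \<in> h ` S} = \<tau> ` {t. t > 0 \<and> \<Phi> t x \<in> S}"
    using img[of "\<lambda>t. \<Psi> t (h x) \<in> h ` S"] by (simp add: \<tau>(3)[symmetric] h_mem_image_iff)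
  have "bdd_below {t. t > 0 \<and> \<Phi> t x \<in> S}"
    by (rule bdd_belowI[of _ 0]) auto
  then show ?thesis
    unfolding eq using strict_mono_surj_Inf_image[OF \<tau>(1,2)] \<tau>(3) by simp
qed

lemma first_in_image: "first_in \<Psi> (h ` S) (h x) = map_option h (first_in \<Phi> S x)"
  using first_time_image[of x S]
  by (auto simp: first_in_def return_times_def frontier_h h_mem_image_iff)

lemma first_out_image: "first_out \<Psi> (h ` S) (h x) = map_option h (first_out \<Phi> S x)"
proof -
  \<comment> \<open>Leaving \<open>S\<close> means entering \<open>- S\<close>, and the bijection
    \<open>h\<close> respects complements.\<close>
  have "h ` (- S) = - h ` S" using bij_h by (rule bij_image_Compl_eq)
  then show ?thesis
    using first_time_image[of x "- S"]
    by (auto simp: first_out_def exit_times_def frontier_h h_mem_image_iff)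
qed

text \<open>Types only record where the two maps are defined and whether they fix the point.
  \<open>map_option h\<close> preserves definedness, and injectivity of \<open>h\<close> preserves
  and reflects being fixed.\<close>

lemma has_type_image: "has_type \<Psi> (h ` A) (h x) T \<longleftrightarrow> has_type \<Phi> A x T"
proof -
  have "h y = h z \<longleftrightarrow> y = z" for y z
    using bij_h by (simp add: bij_def inj_eq)
  then show ?thesis
    by (cases T) (auto simp: first_out_image first_in_image closure_h frontier_h h_mem_image_iff
        dom_def)
qed

end

theorem theoremA:
  fixes \<Phi> :: "real \<Rightarrow> 'a::topological_space \<Rightarrow> 'a"
    and \<Psi> :: "real \<Rightarrow> 'b::topological_space \<Rightarrow> 'b"
    and h :: "'a \<Rightarrow> 'b" and A :: "'a set" and B :: "'b set"
  assumes "flow \<Phi>" and "flow \<Psi>"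
    and "topologically_equivalent_via \<Phi> \<Psi> h"
    and "regular_open_set A" and "regular_open_set B"
    and "B = h ` A"
  shows "\<forall>x \<in> frontier A. h x \<in> frontier B \<and>
           (\<forall>T. has_type \<Phi> A x T \<longleftrightarrow> has_type \<Psi> B (h x) T)"
  using assms(3) by (simp add: assms(6) frontier_h has_type_image)

end
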